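(* Let $K$ be a field, let $N,D\in K[t]$, and suppose $D=t^mE$ with $m\ge 0$ an integer, $E\in K[t]$ and $E(0)\neq0$. Then $$t^m\,\mathrm{Frac}\Big(\frac ND,t^m\Big)=\lceil t^m\rceil\,\frac{N(t)}{E(t)},$$ where $N(t)/E(t)$ is expanded as a power series in $K[[t]]$.
   Context: For $\sum_{n\ge0}a_nt^n\in K[[t]]$, $\lceil t^m\rceil\sum_{n\ge0}a_nt^n=\sum_{n=0}^{m-1}a_nt^n$ (truncation). If $D=D_1D'$ with $D_1,D'\in K[t]$ relatively prime, then $N/D$ can be uniquely written as $p+\frac{r_1}{D_1}+\frac{r'}{D'}$ with $p,r_1,r'\in K[t]$, $\deg r_1<\deg D_1$, $\deg r'<\deg D'$; then $\mathrm{Frac}(N/D,D_1)=r_1/D_1$. *)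

theory Defs
  imports
    "HOL-Computational_Algebra.Polynomial_Factorial"
    "HOL-Computational_Algebra.Polynomial_FPS"
begin

text \<open>
  The library puts \<open>degree 0 = 0\<close>; here the zero polynomial counts as having degree
  \<open>-\<infinity>\<close>, so that \<open>deg r < deg D\<close> forces \<open>r = 0\<close> for a nonzero constant \<open>D\<close>.
\<close>

definition deg_less :: "'a::zero poly \<Rightarrow> 'a poly \<Rightarrow> bool" where
  "deg_less r D \<longleftrightarrow> r = 0 \<or> degree r < degree D"

definition pf_decomp ::
  "'a::field poly \<Rightarrow> 'a poly \<Rightarrow> 'a poly \<Rightarrow> 'a poly \<Rightarrow> 'a poly \<Rightarrow> 'a poly \<Rightarrow> bool" where
  "pf_decomp N D1 D' p r1 r' \<longleftrightarrow>
     Fract N (D1 * D') = to_fract p + Fract r1 D1 + Fract r' D' \<and>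
     deg_less r1 D1 \<and> deg_less r' D'"

text \<open>
  \<open>Frac F D1\<close> depends only on the rational function \<open>F\<close> and on \<open>D1\<close>, not on the chosen
  way \<open>F = N / (D1 * D')\<close> of writing it: see \<open>Frac_eqI\<close> below.
\<close>

definition Frac :: "'a::field poly fract \<Rightarrow> 'a poly \<Rightarrow> 'a poly fract" where
  "Frac F D1 = (THE y. \<exists>N D' p r1 r'.
     D1 \<noteq> 0 \<and> D' \<noteq> 0 \<and> coprime D1 D' \<and> F = Fract N (D1 * D') \<and>
     pf_decomp N D1 D' p r1 r' \<and> y = Fract r1 D1)"

lemma pf_decomp_cross:
  fixes D1 D' :: "'a::field poly"
  assumes "pf_decomp N D1 D' p r1 r'" "D1 \<noteq> 0" "D' \<noteq> 0"
  shows "N = p * D1 * D' + r1 * D' + r' * D1"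
proof -
  have "Fract N (D1 * D') = Fract (p * D1 * D' + r1 * D' + r' * D1) (D1 * D')"
    using assms by (simp add: pf_decomp_def to_fract_def algebra_simps)
  with assms show ?thesis
    by (simp add: eq_fract)
qed

lemma deg_less_dvd_diff:
  fixes D :: "'a::field poly"
  assumes "deg_less r D" "deg_less s D" "D dvd r - s"
  shows "r = s"
proof (rule ccontr)
  assume "r \<noteq> s"
  hence "degree D \<le> degree (r - s)"
    using assms(3) by (intro dvd_imp_degree_le) auto
  moreover have "degree (r - s) < degree D"
    using assms(1,2) \<open>r \<noteq> s\<close> by (auto simp: deg_less_def intro: degree_diff_less)
  ultimately show False by simp
qed

text \<open>
  The library's Bezout identity and \<open>coprime_mult_right_iff\<close> for polynomials need the
  coefficients to be in \<open>field_gcd\<close>.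
\<close>

lemma poly_bezout_coprime:
  fixes D1 D' :: "'a::field poly"
  assumes nz: "D1 \<noteq> 0" and cop: "coprime D1 D'"
  shows "\<exists>a b. a * D1 + b * D' = 1"
proof -
  define I where "I = {a * D1 + b * D' | a b. True}"
  define g where "g = (ARG_MIN degree x. x \<in> I \<and> x \<noteq> 0)"
  have "D1 = 1 * D1 + 0 * D'" "D' = 0 * D1 + 1 * D'" by simp_all
  hence D1_I: "D1 \<in> I" and D'_I: "D' \<in> I"
    unfolding I_def by blast+
  have g: "g \<in> I" "g \<noteq> 0" and g_min: "\<And>x. x \<in> I \<Longrightarrow> x \<noteq> 0 \<Longrightarrow> degree g \<le> degree x"
    using arg_min_nat_lemma[of "\<lambda>x. x \<in> I \<and> x \<noteq> 0" D1 degree] D1_I nz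
    by (auto simp: g_def)
  obtain u v where uv: "g = u * D1 + v * D'"
    using g(1) by (auto simp: I_def)
  have g_dvd: "g dvd x" if x: "x \<in> I" for x
  proof -
    obtain c d where cd: "x = c * D1 + d * D'"
      using x by (auto simp: I_def)
    have "x mod g = x - x div g * g" by (simp add: minus_div_mult_eq_mod)
    also have "\<dots> = (c * D1 + d * D') - x div g * (u * D1 + v * D')"
      using cd uv by simp
    also have "\<dots> = (c - x div g * u) * D1 + (d - x div g * v) * D'"
      by (simp add: algebra_simps)
    finally have "x mod g = (c - x div g * u) * D1 + (d - x div g * v) * D'" .
    hence "x mod g \<in> I" unfolding I_def by blast
    with g_min[of "x mod g"] g(2) degree_mod_less[of g x] have "x mod g = 0"
      by fastforce
    thus ?thesis by auto
  qed
  hence "is_unit g"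
    using cop D1_I D'_I coprime_common_divisor by blast
  then obtain h where "1 = g * h" by auto
  hence "(h * u) * D1 + (h * v) * D' = 1"
    by (simp add: uv algebra_simps)
  thus ?thesis by blast
qed

lemma pf_decomp_unique_part:
  fixes D1 D' D'' :: "'a::field poly"
  assumes nz: "D1 \<noteq> 0" "D' \<noteq> 0" "D'' \<noteq> 0"
    and cop: "coprime D1 D'" "coprime D1 D''"
    and eq: "Fract N (D1 * D') = Fract M (D1 * D'')"
    and dec: "pf_decomp N D1 D' p r1 r'" "pf_decomp M D1 D'' q s1 s'"
  shows "r1 = s1"
proof -
  have "N * (D1 * D'') = M * (D1 * D')"
    using eq nz by (simp add: eq_fract)
  hence *: "N * D'' = M * D'"
    using nz by (metis mult.left_commute mult_cancel_left)
  have "(r1 - s1) * (D' * D'') = D1 * ((s' * D' - r' * D'') + (q - p) * D' * D'')"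
    using * unfolding pf_decomp_cross[OF dec(1) nz(1,2)] pf_decomp_cross[OF dec(2) nz(1,3)]
    by (simp add: algebra_simps)
  hence dvd: "D1 dvd (r1 - s1) * (D' * D'')" by simp
  obtain a b where ab: "a * D1 + b * D' = 1"
    using poly_bezout_coprime[OF nz(1) cop(1)] by blast
  obtain c d where cd: "c * D1 + d * D'' = 1"
    using poly_bezout_coprime[OF nz(1) cop(2)] by blast
  have "r1 - s1 = (r1 - s1) * ((a * D1 + b * D') * (c * D1 + d * D''))"
    by (simp add: ab cd)
  also have "\<dots> = D1 * ((r1 - s1) * (a * c * D1 + a * d * D'' + b * c * D')) +
      b * d * ((r1 - s1) * (D' * D''))"
    by (simp add: algebra_simps)
  also have "D1 dvd \<dots>"
    by (intro dvd_add dvd_triv_left dvd_mult[OF dvd])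
  finally have "D1 dvd r1 - s1" .
  thus ?thesis
    using dec deg_less_dvd_diff unfolding pf_decomp_def by blast
qed

lemma pf_decomp_exists:
  fixes D1 D' :: "'a::field poly"
  assumes nz: "D1 \<noteq> 0" "D' \<noteq> 0" and cop: "coprime D1 D'"
  shows "\<exists>p r1 r'. pf_decomp N D1 D' p r1 r'"
proof -
  obtain a b where ab: "a * D1 + b * D' = 1"
    using poly_bezout_coprime[OF nz(1) cop] by blast
  define p where "p = (N * b) div D1 + (N * a) div D'"
  define r1 where "r1 = (N * b) mod D1"
  define r' where "r' = (N * a) mod D'"
  have "N = (N * b) * D' + (N * a) * D1"
    using arg_cong[OF ab, of "\<lambda>x. N * x"] by (simp add: algebra_simps)
  also have "N * b = N * b div D1 * D1 + r1" by (simp add: r1_def)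
  also have "N * a = N * a div D' * D' + r'" by (simp add: r'_def)
  finally have "N = p * D1 * D' + r1 * D' + r' * D1"
    by (simp add: p_def algebra_simps)
  moreover have "deg_less r1 D1" "deg_less r' D'"
    using degree_mod_less[OF nz(1), of "N * b"] degree_mod_less[OF nz(2), of "N * a"]
    by (auto simp: deg_less_def r1_def r'_def)
  ultimately have "pf_decomp N D1 D' p r1 r'"
    using nz by (simp add: pf_decomp_def to_fract_def algebra_simps)
  thus ?thesis by blast
qed

lemma Frac_eqI:
  fixes D1 D' :: "'a::field poly"
  assumes "D1 \<noteq> 0" "D' \<noteq> 0" "coprime D1 D'" "pf_decomp N D1 D' p r1 r'"
  shows "Frac (Fract N (D1 * D')) D1 = Fract r1 D1"
  unfolding Frac_def
proof (rule the_equality)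
  show "\<exists>N' D'' p r1' r'. D1 \<noteq> 0 \<and> D'' \<noteq> 0 \<and> coprime D1 D'' \<and>
      Fract N (D1 * D') = Fract N' (D1 * D'') \<and> pf_decomp N' D1 D'' p r1' r' \<and>
      Fract r1 D1 = Fract r1' D1"
    using assms by blast
next
  fix y
  assume "\<exists>N' D'' p r1 r'. D1 \<noteq> 0 \<and> D'' \<noteq> 0 \<and> coprime D1 D'' \<and>
      Fract N (D1 * D') = Fract N' (D1 * D'') \<and> pf_decomp N' D1 D'' p r1 r' \<and>
      y = Fract r1 D1"
  then show "y = Fract r1 D1"
    using pf_decomp_unique_part[OF assms(1,2) _ assms(3) _ _ assms(4)] by blast
qed

end

theory Submission
  imports Defs
begin

text \<open>
  Clearing denominators in the partial fraction decomposition and dividing by \<open>E\<close> gives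
  \<open>N/E = r\<^sub>1 + t\<^sup>m q/E\<close> in \<open>K[[t]]\<close> with \<open>q\<close> a polynomial. As \<open>deg r\<^sub>1 < m\<close>, truncation keeps
  exactly \<open>r\<^sub>1 = t\<^sup>m Frac(N/D, t\<^sup>m)\<close>.
\<close>

text \<open>As \<open>E\<close> is a unit in the power series ring, truncating its inverse gives a
  polynomial \<open>T\<close> with \<open>T * E\<close> congruent to 1 modulo
  \<open>monom 1 m\<close>; a common divisor then divides 1.\<close>

lemma coprime_monom_1:
  fixes E :: "'a::field poly"
  assumes "poly E 0 \<noteq> 0"
  shows "coprime (monom 1 m) E"
proof (rule coprimeI)
  fix c assume c: "c dvd monom 1 m" "c dvd E"
  define T where "T = truncate_fps m (inverse (fps_of_poly E))"
  have E0: "fps_nth (fps_of_poly E) 0 \<noteq> 0"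
    using assms by (simp add: poly_0_coeff_0)
  have "coeff (1 - T * E) k = 0" if "k < m" for k
  proof -
    have "coeff (T * E) k =
        fps_nth (fps_cutoff m (inverse (fps_of_poly E)) * fps_of_poly E) k"
      unfolding T_def by (metis fps_of_poly_mult fps_of_poly_nth fps_of_poly_truncate)
    \<comment> \<open>Coefficient \<open>k\<close> of a product involves only coefficients of index
      at most \<open>k\<close>, so for \<open>k < m\<close> the cutoff is invisible.\<close>
    also have "\<dots> = fps_nth 1 k"
      using that E0 by (simp add: fps_cutoff_left_mult_nth inverse_mult_eq_1[OF E0])
    finally show ?thesis by simp
  qed
  hence "monom 1 m dvd 1 - T * E"
    by (simp add: monom_1_dvd_iff')
  with c have "c dvd (1 - T * E) + T * E"
    by (intro dvd_add dvd_mult) (auto intro: dvd_trans)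
  thus "is_unit c" by simp
qed

lemma truncate_fps_X_power_mult [simp]:
  "truncate_fps m (fps_X ^ m * f) = 0"
  by (rule poly_eqI) (simp add: coeff_truncate_fps fps_X_power_mult_nth)

text \<open>For \<open>m = 0\<close> both sides vanish, because \<open>deg_less r 1\<close> forces
  \<open>r = 0\<close>.\<close>

lemma truncate_fps_of_poly:
  assumes "deg_less r (monom (1 :: 'a::field) m)"
  shows "truncate_fps m (fps_of_poly r) = r"
  using assms
  by (intro poly_eqI) (auto simp: coeff_truncate_fps deg_less_def degree_monom_eq intro: coeff_eq_0)

theorem mainTheorem10:
  fixes N D E :: "'a::field poly" and m :: nat
  assumes "D = monom 1 m * E"
    and "poly E 0 \<noteq> 0"
  shows "to_fract (monom 1 m) * Frac (Fract N D) (monom 1 m) =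
         to_fract (truncate_fps m (fps_of_poly N / fps_of_poly E))"
proof -
  have nz: "monom (1 :: 'a) m \<noteq> 0" "E \<noteq> 0"
    using assms(2) by auto
  have cop: "coprime (monom 1 m) E"
    using assms(2) by (rule coprime_monom_1)
  obtain p r1 r' where dec: "pf_decomp N (monom 1 m) E p r1 r'"
    using pf_decomp_exists[OF nz cop] by blast
  define e where "e = fps_of_poly E"
  have e0: "fps_nth e 0 \<noteq> 0"
    using assms(2) by (simp add: e_def poly_0_coeff_0)
  \<comment> \<open>Polynomial part and cofactor part are collected into one multiple of
    \<open>monom 1 m\<close>, so \<open>q\<close> is \<open>p * E + r'\<close>.\<close>
  have "N = r1 * E + monom 1 m * (p * E + r')"
    using pf_decomp_cross[OF dec nz] by (simp add: algebra_simps)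
  hence "fps_of_poly N = fps_of_poly r1 * e + fps_X ^ m * fps_of_poly (p * E + r')"
    by (simp only: fps_of_poly_add fps_of_poly_mult fps_of_poly_monom' e_def)
  hence "fps_of_poly N / e =
      fps_of_poly r1 * (inverse e * e) + fps_X ^ m * (fps_of_poly (p * E + r') * inverse e)"
    by (simp only: fps_divide_unit[OF e0] algebra_simps)
  also have "inverse e * e = 1"
    using e0 by (rule inverse_mult_eq_1)
  \<comment> \<open>Truncation is additive and kills the multiple of
    \<open>fps_X ^ m\<close>.\<close>
  finally have "truncate_fps m (fps_of_poly N / e) = truncate_fps m (fps_of_poly r1)"
    by (simp add: truncate_fps_add)
  also have "\<dots> = r1"
    using dec by (simp add: pf_decomp_def truncate_fps_of_poly)
  finally have "truncate_fps m (fps_of_poly N / fps_of_poly E) = r1"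
    by (simp add: e_def)
  moreover have "Frac (Fract N D) (monom 1 m) = Fract r1 (monom 1 m)"
    unfolding assms(1) using Frac_eqI[OF nz cop dec] .
  ultimately show ?thesis
    using nz(1) by (simp add: to_fract_def eq_fract)
qed

end
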